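(* For each $\alpha >0$ define $\mathsf{A}_\alpha=\{A_1,\alpha A_2\}$ where \[A_1:=\begin{pmatrix}1&1\\0&1\end{pmatrix},\qquad A_2:=\begin{pmatrix}1&0\\1&1\end{pmatrix}.\] Then for each $\alpha \in (0,1]$ the pair $\mathsf{A}_\alpha$ has a unique Barabanov norm (on $\mathbb{C}^2$).
   Context: The joint spectral radius of a finite set $\mathsf{A}$ of $d\times d$ complex matrices is $\varrho(\mathsf{A})=\lim_{n\to\infty}\max\{\|B_1\cdots B_n\|^{1/n}\colon B_1,\dots,B_n\in\mathsf{A}\}$, where $\|\cdot\|$ is the operator norm induced by the Euclidean norm. A norm $|\!|\!|\cdot|\!|\!|$ on $\mathbb{C}^d$ is a Barabanov norm for $\mathsf{A}$ if $\varrho(\mathsf{A})|\!|\!|v|\!|\!|=\max_{A\in\mathsf{A}}|\!|\!|Av|\!|\!|$ for all $v\in\mathbb{C}^d$. $\mathsf{A}$ has a unique Barabanov norm if it has at least one Barabanov norm and any two Barabanov norms for $\mathsf{A}$ are positive scalar multiples of one another. *)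

theory Defs
  imports "HOL-Analysis.Analysis"
begin

text \<open>
  The norm of the library on \<open>complex ^ 'n\<close> is the Euclidean one, so
  \<open>onorm ((*v) M)\<close> is the operator norm of \<open>M\<close> induced by it.
\<close>

definition mat_list_prod :: "('a::semiring_1 ^ 'n ^ 'n) list \<Rightarrow> 'a ^ 'n ^ 'n" where
  "mat_list_prod Bs = foldr (**) Bs (mat 1)"

text \<open>
  Meaningful for finite nonempty \<open>\<A>\<close>, where the limit exists. The term at
  \<open>n = 0\<close> is the junk value \<open>root 0 _ = 0\<close>, which does not affect the limit.
\<close>

definition joint_spectral_radius :: "(complex ^ 'n ^ 'n) set \<Rightarrow> real" where
  "joint_spectral_radius \<A> =
     lim (\<lambda>n. Max {root n (onorm ((*v) (mat_list_prod Bs))) | Bs. length Bs = n \<and> set Bs \<subseteq> \<A>})"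

definition is_norm :: "(complex ^ 'n \<Rightarrow> real) \<Rightarrow> bool" where
  "is_norm N \<longleftrightarrow>
     (\<forall>v. 0 \<le> N v) \<and>
     (\<forall>v. N v = 0 \<longleftrightarrow> v = 0) \<and>
     (\<forall>c v. N (c *s v) = cmod c * N v) \<and>
     (\<forall>v w. N (v + w) \<le> N v + N w)"

definition barabanov_norm :: "(complex ^ 'n ^ 'n) set \<Rightarrow> (complex ^ 'n \<Rightarrow> real) \<Rightarrow> bool" where
  "barabanov_norm \<A> N \<longleftrightarrow>
     is_norm N \<and> (\<forall>v. joint_spectral_radius \<A> * N v = Max {N (A *v v) | A. A \<in> \<A>})"

definition has_unique_barabanov_norm :: "(complex ^ 'n ^ 'n) set \<Rightarrow> bool" where
  "has_unique_barabanov_norm \<A> \<longleftrightarrow>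
     (\<exists>N. barabanov_norm \<A> N) \<and>
     (\<forall>N N'. barabanov_norm \<A> N \<longrightarrow> barabanov_norm \<A> N' \<longrightarrow>
        (\<exists>c>0. \<forall>v. N' v = c * N v))"

definition A1 :: "complex ^ 2 ^ 2" where
  "A1 = vector [vector [1, 1],
                vector [0, 1]]"

definition A2 :: "complex ^ 2 ^ 2" where
  "A2 = vector [vector [1, 0],
                vector [1, 1]]"

definition A_pair :: "real \<Rightarrow> (complex ^ 2 ^ 2) set" where
  "A_pair \<alpha> = {A1, \<alpha> *\<^sub>R A2}"

end

theory Submission
  imports Defs
begin

text \<open>
  A Barabanov norm is determined by its values on the real nonnegative cone, because long
  products map every vector close to a multiple of a vector of the cone. On the cone a
  Barabanov norm is monotone, so an extremal trajectory applies \<open>A\<^sub>1\<close> on one side of a threshold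
  direction and \<open>\<alpha> A\<^sub>2\<close> on the other. If the ratio of two Barabanov norms were not constant, the
  directions where it is maximal and those where it is minimal would form disjoint compact
  sets, each containing a trajectory extremal for both norms from every one of its points. This
  is impossible, since both matrices contract directions strictly and preserve their order.
\<close>

subsection \<open>The joint spectral radius from a Barabanov norm\<close>

text \<open>Products flatten vectors onto the cone because length and area compete.
  \<open>A1\<close> fixes \<open>(1, 0)\<close> but has unbounded powers, which forces the expansion
  factor \<open>r\<close> above 1; for \<alpha> \<le> 1 every product has determinant at most 1 in
  absolute value. A product that expands one vector by \<open>r ^ n\<close> therefore leaves only a
  bounded component transverse to it, negligible after division by \<open>r ^ n\<close>. Existence
  is a separate construction. The norm is the limit superior of the maximal growth over products of
  length \<open>n\<close>, divided by \<open>r ^ n\<close>. Nonnegative entries make this growth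
  multiplicative up to a constant factor, so the quotients stay bounded and do not tend to 0 at
  \<open>(1, 1)\<close>. The Barabanov equation is studied with an arbitrary constant
  \<open>r\<close>; only the passage back to matrices identifies it with the joint spectral
  radius.\<close>

lemma is_norm_equivalent:
  fixes N :: "complex ^ 'n \<Rightarrow> real"
  assumes "is_norm N"
  shows "\<exists>c>0. \<exists>C>0. \<forall>v. c * norm v \<le> N v \<and> N v \<le> C * norm v"
proof -
  have nn: "0 \<le> N v" and z: "N v = 0 \<longleftrightarrow> v = 0" and hom: "N (a *s v) = cmod a * N v"
    and tri: "N (v + w) \<le> N v + N w" for v w a
    using assms unfolding is_norm_def by blast+
  have N_sum: "N (sum f S) \<le> (\<Sum>i\<in>S. N (f i))" if "finite S" for S and f :: "'n \<Rightarrow> complex ^ 'n"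
    using that
  proof (induction S rule: finite_induct)
    case empty
    then show ?case using z[of 0] by simp
  next
    case (insert x S)
    then show ?case using tri[of "f x" "sum f S"] by simp
  qed
  define C where "C = (\<Sum>i\<in>UNIV. N (axis i 1)) + 1"
  have "C > 0" unfolding C_def using nn by (simp add: add_nonneg_pos sum_nonneg)
  have upper: "N v \<le> C * norm v" for v
  proof -
    have "N v = N (\<Sum>i\<in>UNIV. v $ i *s axis i 1)" by (simp add: basis_expansion)
    also have "\<dots> \<le> (\<Sum>i\<in>UNIV. cmod (v $ i) * N (axis i 1))"
      using N_sum[of UNIV "\<lambda>i. v $ i *s axis i 1"] by (simp add: hom)
    also have "\<dots> \<le> (\<Sum>i\<in>UNIV. norm v * N (axis i 1))"
      by (intro sum_mono mult_right_mono) (auto simp: nn intro: Finite_Cartesian_Product.norm_nth_le)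
    also have "\<dots> \<le> C * norm v"
      unfolding C_def by (simp add: sum_distrib_left[symmetric] algebra_simps)
    finally show ?thesis .
  qed
  have sym: "N (- v) = N v" for v using hom[of "-1" v] by simp
  have lip: "\<bar>N v - N w\<bar> \<le> C * norm (v - w)" for v w
    using tri[of "v - w" w] tri[of "w - v" v] upper[of "v - w"] upper[of "w - v"]
    by (simp add: norm_minus_commute abs_le_iff)
  have cont: "continuous_on UNIV N"
    by (rule lipschitz_on_continuous_on[of C], rule lipschitz_onI)
       (use lip \<open>C > 0\<close> in \<open>auto simp: dist_norm\<close>)
  define S where "S = sphere (0 :: complex ^ 'n) 1"
  have "compact S" "S \<noteq> {}" unfolding S_def by (auto simp: sphere_eq_empty)
  then obtain u where u: "u \<in> S" "\<forall>v\<in>S. N u \<le> N v"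
    using continuous_attains_inf[of S N] continuous_on_subset[OF cont] by blast
  then have "u \<noteq> 0" unfolding S_def by auto
  then have "N u > 0" using z nn by (metis less_eq_real_def)
  moreover have "N u * norm v \<le> N v" for v
  proof (cases "v = 0")
    case False
    have "inverse (norm v) *\<^sub>R v \<in> S" using False unfolding S_def by simp
    then have "N u \<le> N (inverse (norm v) *\<^sub>R v)" using u by blast
    also have "inverse (norm v) *\<^sub>R v = complex_of_real (inverse (norm v)) *s v"
      by (simp only: vec_eq_iff vector_scaleR_component vector_smult_component)
         (simp add: scaleR_conv_of_real)
    also have "N \<dots> = N v / norm v" unfolding hom norm_of_real by (simp add: field_simps)
    finally show ?thesis using False by (simp add: field_simps)
  qed (simp add: nn)
  ultimately show ?thesis using upper \<open>C > 0\<close> by blast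
qed

text \<open>No product of length \<open>n\<close> expands \<open>N\<close> by more than
  \<open>r ^ n\<close>, and choosing an optimal matrix at each step attains this factor on a fixed
  vector. Hence solving the Barabanov equation with any constant is enough for existence.\<close>

lemma joint_spectral_radius_eq:
  fixes \<A> :: "(complex ^ 'n ^ 'n) set"
  assumes fin: "finite \<A>" "\<A> \<noteq> {}" and N: "is_norm N"
    and r: "\<And>v. r * N v = Max {N (A *v v) | A. A \<in> \<A>}"
  shows "joint_spectral_radius \<A> = r"
proof -
  obtain c C where c: "c > 0" "C > 0" "\<And>v. c * norm v \<le> N v" "\<And>v. N v \<le> C * norm v"
    using is_norm_equivalent[OF N] by blast
  have nn: "0 \<le> N v" and z: "N v = 0 \<longleftrightarrow> v = 0" for v using N unfolding is_norm_def by blast+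
  have fin': "finite {N (A *v v) | A. A \<in> \<A>}" "{N (A *v v) | A. A \<in> \<A>} \<noteq> {}" for v
    using fin by (auto simp: Setcompr_eq_image)
  have step: "N (A *v v) \<le> r * N v" if "A \<in> \<A>" for A v
    unfolding r using fin'[of v] that by (intro Max_ge) auto
  have opt: "\<exists>A\<in>\<A>. N (A *v v) = r * N v" for v
    unfolding r using Max_in[OF fin'[of v]] by auto
  define e :: "complex ^ 'n" where "e = axis undefined 1"
  have e: "norm e = 1" "N e > 0"
    unfolding e_def using nn z by (auto simp: order_less_le axis_eq_0_iff)
  have r0: "r \<ge> 0"
    using opt[of e] nn e(2) by (metis zero_le_mult_iff not_less)
  have bl: "bounded_linear ((*v) M)" for M :: "complex ^ 'n ^ 'n"
    by (rule matrix_vector_mul_bounded_linear)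
  have up: "N (mat_list_prod Bs *v v) \<le> r ^ length Bs * N v" if "set Bs \<subseteq> \<A>" for Bs v
    using that
  proof (induction Bs)
    case (Cons B Bs)
    then show ?case
      using step[of B "mat_list_prod Bs *v v"] mult_left_mono[OF _ r0]
      by (fastforce simp: mat_list_prod_def matrix_vector_mul_assoc mult.assoc intro: order_trans)
  qed (simp add: mat_list_prod_def)
  have ex: "\<exists>Bs. length Bs = n \<and> set Bs \<subseteq> \<A> \<and> N (mat_list_prod Bs *v e) = r ^ n * N e" for n
  proof (induction n)
    case (Suc n)
    then obtain Bs where Bs: "length Bs = n" "set Bs \<subseteq> \<A>" "N (mat_list_prod Bs *v e) = r ^ n * N e"
      by blast
    obtain A where "A \<in> \<A>" "N (A *v (mat_list_prod Bs *v e)) = r * N (mat_list_prod Bs *v e)"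
      using opt by blast
    with Bs show ?case
      by (intro exI[of _ "A # Bs"]) (simp add: mat_list_prod_def matrix_vector_mul_assoc)
  qed (simp add: mat_list_prod_def)
  \<comment> \<open>Passing between \<open>N\<close> and the Euclidean norm costs only the factors
    \<open>K\<close> and \<open>k\<close>, whose \<open>n\<close>-th roots tend to 1.\<close>
  define K where "K = C / c"
  define k where "k = N e / C"
  have "K > 0" "k > 0" using c e by (auto simp: K_def k_def)
  define X where "X n = {root n (onorm ((*v) (mat_list_prod Bs))) | Bs. length Bs = n \<and> set Bs \<subseteq> \<A>}" for n
  have Xfin: "finite (X n)" for n
    using finite_lists_length_eq[OF fin(1), of n]
    unfolding X_def Setcompr_eq_image by (simp add: conj_commute)
  have Xle: "Max (X n) \<le> root n K * r" if "n > 0" for n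
  proof (rule Max.boundedI[OF Xfin])
    show "X n \<noteq> {}" using ex[of n] unfolding X_def by blast
    fix x assume "x \<in> X n"
    then obtain Bs where Bs: "x = root n (onorm ((*v) (mat_list_prod Bs)))" "length Bs = n" "set Bs \<subseteq> \<A>"
      unfolding X_def by blast
    have "onorm ((*v) (mat_list_prod Bs)) \<le> K * r ^ n"
    proof (rule onorm_bound)
      show "0 \<le> K * r ^ n" using \<open>K > 0\<close> r0 by simp
      fix v
      have "c * norm (mat_list_prod Bs *v v) \<le> r ^ n * (C * norm v)"
        using c(3)[of "mat_list_prod Bs *v v"] up[OF Bs(3), of v] mult_left_mono[OF c(4)[of v], of "r ^ n"] r0 Bs
        by simp
      then show "norm (mat_list_prod Bs *v v) \<le> K * r ^ n * norm v"
        using c by (simp add: K_def field_simps)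
    qed
    then have "x \<le> root n (K * r ^ n)" unfolding Bs using that by simp
    then show "x \<le> root n K * r"
      using that r0 by (simp add: real_root_mult real_root_power_cancel)
  qed
  have Xge: "root n k * r \<le> Max (X n)" if "n > 0" for n
  proof -
    obtain Bs where Bs: "length Bs = n" "set Bs \<subseteq> \<A>" "N (mat_list_prod Bs *v e) = r ^ n * N e"
      using ex by blast
    have "r ^ n * N e \<le> C * onorm ((*v) (mat_list_prod Bs))"
      using order_trans[OF c(4)[of "mat_list_prod Bs *v e"]
        mult_left_mono[OF onorm[OF bl, of "mat_list_prod Bs" e], of C]] e c(2)
      unfolding Bs(3) by simp
    then have "k * r ^ n \<le> onorm ((*v) (mat_list_prod Bs))"
      using c by (simp add: k_def field_simps)
    then have "root n (k * r ^ n) \<le> root n (onorm ((*v) (mat_list_prod Bs)))"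
      using that by simp
    also have "\<dots> \<le> Max (X n)"
      using Bs by (intro Max_ge[OF Xfin]) (auto simp: X_def)
    finally show ?thesis using that r0 by (simp add: real_root_mult real_root_power_cancel)
  qed
  have "(\<lambda>n. Max (X n)) \<longlonglongrightarrow> r"
  proof (rule tendsto_sandwich[where f = "\<lambda>n. root n k * r" and h = "\<lambda>n. root n K * r"])
    show "\<forall>\<^sub>F n in sequentially. root n k * r \<le> Max (X n)"
      using eventually_gt_at_top[of 0] by eventually_elim (rule Xge)
    show "\<forall>\<^sub>F n in sequentially. Max (X n) \<le> root n K * r"
      using eventually_gt_at_top[of 0] by eventually_elim (rule Xle)
    show "(\<lambda>n. root n k * r) \<longlonglongrightarrow> r"
      using tendsto_mult_right[OF LIMSEQ_root_const[OF \<open>k > 0\<close>], of r] by simp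
    show "(\<lambda>n. root n K * r) \<longlonglongrightarrow> r"
      using tendsto_mult_right[OF LIMSEQ_root_const[OF \<open>K > 0\<close>], of r] by simp
  qed
  then show ?thesis unfolding joint_spectral_radius_def X_def by (rule limI)
qed

subsection \<open>Barabanov norms in coordinates\<close>

text \<open>Resolves \<open>(z, w)\<close> along \<open>(p, q)\<close> and the fixed vector
  \<open>(1, -1)\<close>. The coefficient of \<open>(1, -1)\<close> is a determinant over
  \<open>p + q\<close>, so bounding \<open>D\<close> above and \<open>p + q\<close> below controls
  it. Real and complex vectors are both split this way.\<close>

lemma split_along:
  fixes z w p q D :: "'a::field"
  assumes "p + q \<noteq> 0" and "z * q - w * p = D"
  shows "z = (z + w) / (p + q) * p + D / (p + q)" "w = (z + w) / (p + q) * q - D / (p + q)"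
proof -
  have "z * (p + q) = (z + w) * p + D" "w * (p + q) = (z + w) * q - D"
    using assms(2)[symmetric] by (simp_all add: algebra_simps)
  then show "z = (z + w) / (p + q) * p + D / (p + q)" and "w = (z + w) / (p + q) * q - D / (p + q)"
    using assms(1) by (simp_all add: eq_divide_eq flip: add_divide_distrib diff_divide_distrib)
qed

text \<open>A Barabanov norm in coordinates. The constant \<open>r\<close> is left free so that a
  solution can be constructed before its \<open>r\<close> is known to be the joint spectral
  radius.\<close>

locale barabanov_pair =
  fixes \<alpha> r :: real and F :: "complex \<Rightarrow> complex \<Rightarrow> real"
  assumes \<alpha>_pos: "0 < \<alpha>" and \<alpha>_le1: "\<alpha> \<le> 1"
    and nonneg: "0 \<le> F x y"
    and definite: "F x y = 0 \<Longrightarrow> x = 0 \<and> y = 0"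
    and hom: "F (c * x) (c * y) = cmod c * F x y"
    and triangle: "F (x + x') (y + y') \<le> F x y + F x' y'"
    and step: "r * F x y = max (F (x + y) y) (\<alpha> * F x (x + y))"
begin

section \<open>Expansion, optimal products and reduction to the cone\<close>

lemma pos: "x \<noteq> 0 \<or> y \<noteq> 0 \<Longrightarrow> 0 < F x y"
  using nonneg[of x y] definite[of x y] by fastforce

lemma hom_real: "0 \<le> t \<Longrightarrow> F (of_real t * x) (of_real t * y) = t * F x y"
  using hom[of "of_real t"] by simp

lemma le1: "F (x + y) y \<le> r * F x y" and le2: "\<alpha> * F x (x + y) \<le> r * F x y"
  using step[of x y] by auto

lemma le_sum: "F x y \<le> cmod x * F 1 0 + cmod y * F 0 1"
  using triangle[of x 0 0 y] hom[of x 1 0] hom[of y 0 1] by simp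

lemma triangle_diff: "F x y - F x' y' \<le> F (x + x') (y + y')"
  using triangle[of "x + x'" "-x'" "y + y'" "-y'"] hom[of "-1" x' y'] by simp

text \<open>The fixed vector \<open>(1, 0)\<close> of \<open>A1\<close> gives
  \<open>r \<ge> 1\<close>. With \<open>r = 1\<close> the orbit \<open>(n, 1)\<close> of
  \<open>(0, 1)\<close> under \<open>A1\<close> would stay bounded.\<close>

lemma r_gt1: "1 < r"
proof -
  have e: "0 < F 1 0" "0 < F 0 1" by (auto intro: pos)
  have "1 \<le> r" using le1[of 1 0] e by simp
  moreover have False if "r = 1"
  proof -
    have orbit: "F (of_nat n) 1 \<le> F 0 1" for n
    proof (induction n)
      case (Suc n)
      then show ?case using le1[of "of_nat n" 1] that by (simp add: add.commute)
    qed simp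
    obtain n :: nat where "2 * F 0 1 / F 1 0 < of_nat n" using reals_Archimedean2 by blast
    then have n: "2 * F 0 1 < of_nat n * F 1 0" using e by (simp add: field_simps)
    show False
      using orbit[of n] triangle_diff[of "of_nat n" 0 0 1] hom[of "of_nat n" 1 0] n by simp
  qed
  ultimately show ?thesis by fastforce
qed

text \<open>The numbers \<open>a\<close>, \<open>b\<close>, \<open>c\<close>, \<open>d\<close> are
  the entries of a product of \<open>n\<close> letters, each new letter being optimal for the
  current image. The determinant bound survives because the letters have determinants 1 and
  \<open>\<alpha>\<^sup>2\<close>. The bound for every \<open>G\<close> with the same
  \<open>r\<close> lets one product serve two norms at once in \<open>le_extend\<close>.\<close>

lemma optimal_product:
  "\<exists>a b c d. 0 \<le> a \<and> 0 \<le> b \<and> 0 \<le> c \<and> 0 \<le> d \<and> \<bar>a * d - b * c\<bar> \<le> 1 \<and>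
    F (of_real a * x + of_real b * y) (of_real c * x + of_real d * y) = r ^ n * F x y \<and>
    (\<forall>G. barabanov_pair \<alpha> r G \<longrightarrow>
      (\<forall>z w. G (of_real a * z + of_real b * w) (of_real c * z + of_real d * w) \<le> r ^ n * G z w))"
proof (induction n)
  case 0
  show ?case by (intro exI[of _ 1] exI[of _ 0]) simp
next
  case (Suc n)
  then obtain a b c d :: real where L: "0 \<le> a" "0 \<le> b" "0 \<le> c" "0 \<le> d" "\<bar>a * d - b * c\<bar> \<le> 1"
    "F (of_real a * x + of_real b * y) (of_real c * x + of_real d * y) = r ^ n * F x y"
    and G: "\<And>G z w. barabanov_pair \<alpha> r G \<Longrightarrow>
      G (of_real a * z + of_real b * w) (of_real c * z + of_real d * w) \<le> r ^ n * G z w"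
    by blast
  have r0: "0 \<le> r" using r_gt1 by simp
  let ?p = "of_real a * x + of_real b * y" and ?q = "of_real c * x + of_real d * y"
  consider "F (?p + ?q) ?q = r * F ?p ?q" | "\<alpha> * F ?p (?p + ?q) = r * F ?p ?q"
    using step[of ?p ?q] by (metis max_def)
  then show ?case
  proof cases
    case 1
    have "F (of_real (a + c) * x + of_real (b + d) * y) (of_real c * x + of_real d * y) = r ^ Suc n * F x y"
      using 1 L(6) by (simp add: algebra_simps)
    moreover have "G (of_real (a + c) * z + of_real (b + d) * w) (of_real c * z + of_real d * w) \<le> r ^ Suc n * G z w"
      if "barabanov_pair \<alpha> r G" for G z w
      using barabanov_pair.le1[OF that, of "of_real a * z + of_real b * w" "of_real c * z + of_real d * w"]
        mult_left_mono[OF G[OF that, of z w] r0]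
      by (simp add: algebra_simps)
    moreover have "(a + c) * d - (b + d) * c = a * d - b * c" by (simp add: algebra_simps)
    ultimately show ?thesis using L
      by (intro exI[of _ "a + c"] exI[of _ "b + d"] exI[of _ c] exI[of _ d]) simp
  next
    case 2
    have shift: "G (of_real (\<alpha> * a) * z + of_real (\<alpha> * b) * w) (of_real (\<alpha> * (a + c)) * z + of_real (\<alpha> * (b + d)) * w)
      = \<alpha> * G (of_real a * z + of_real b * w) (of_real a * z + of_real b * w + (of_real c * z + of_real d * w))"
      if "barabanov_pair \<alpha> r G" for G z w
      using barabanov_pair.hom_real[OF that, of \<alpha> "of_real a * z + of_real b * w"
          "of_real a * z + of_real b * w + (of_real c * z + of_real d * w)"] \<alpha>_pos
      by (simp add: algebra_simps)
    have "F (of_real (\<alpha> * a) * x + of_real (\<alpha> * b) * y) (of_real (\<alpha> * (a + c)) * x + of_real (\<alpha> * (b + d)) * y) = r ^ Suc n * F x y"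
      unfolding shift[OF barabanov_pair_axioms] 2 using L(6) by simp
    moreover have "G (of_real (\<alpha> * a) * z + of_real (\<alpha> * b) * w) (of_real (\<alpha> * (a + c)) * z + of_real (\<alpha> * (b + d)) * w) \<le> r ^ Suc n * G z w"
      if "barabanov_pair \<alpha> r G" for G z w
      unfolding shift[OF that]
      using barabanov_pair.le2[OF that, of "of_real a * z + of_real b * w" "of_real c * z + of_real d * w"]
        mult_left_mono[OF G[OF that, of z w] r0]
      by simp
    moreover have "\<bar>\<alpha> * a * (\<alpha> * (b + d)) - \<alpha> * b * (\<alpha> * (a + c))\<bar> \<le> 1"
    proof -
      have "\<alpha> * a * (\<alpha> * (b + d)) - \<alpha> * b * (\<alpha> * (a + c)) = \<alpha>\<^sup>2 * (a * d - b * c)"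
        by (simp add: algebra_simps power2_eq_square)
      moreover have "\<alpha>\<^sup>2 \<le> 1" using \<alpha>_pos \<alpha>_le1 by (simp add: power_le_one)
      ultimately show ?thesis using L(5) by (simp add: abs_mult mult_le_one)
    qed
    ultimately show ?thesis using L \<alpha>_pos
      by (intro exI[of _ "\<alpha> * a"] exI[of _ "\<alpha> * b"] exI[of _ "\<alpha> * (a + c)"] exI[of _ "\<alpha> * (b + d)"]) simp
  qed
qed

text \<open>As products have determinant at most 1, the second coordinate of the image of a vector in
  the basis formed by an optimally expanded vector and \<open>(1, -1)\<close> stays bounded, so it vanishes
  after division by \<open>r ^ n\<close>.\<close>
lemma mono_cone:
  assumes "0 \<le> x" "0 \<le> y" "0 \<le> s" "0 \<le> t"
  shows "F (of_real x) (of_real y) \<le> F (of_real (x + s)) (of_real (y + t))"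
proof (cases "x = 0 \<and> y = 0")
  case True
  then show ?thesis using le_sum[of 0 0] nonneg by (simp add: order_trans)
next
  case False
  define m where "m = F (of_real x) (of_real y)"
  have "m > 0" unfolding m_def using pos False by simp
  define C where "C = F 1 0 + F 0 1"
  have "C > 0" unfolding C_def using pos[of 1 0] pos[of 0 1] by simp
  define K where "K = \<bar>s * y - t * x\<bar> * C / m * F 1 (-1)"
  have "m - F (of_real (x + s)) (of_real (y + t)) \<le> K / r ^ n" for n
  proof -
    obtain a b c d :: real where L: "0 \<le> a" "0 \<le> b" "0 \<le> c" "0 \<le> d" "\<bar>a * d - b * c\<bar> \<le> 1"
      "F (of_real a * of_real x + of_real b * of_real y) (of_real c * of_real x + of_real d * of_real y) = r ^ n * m"
      and G: "\<And>z w. F (of_real a * z + of_real b * w) (of_real c * z + of_real d * w) \<le> r ^ n * F z w"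
      using optimal_product[of "of_real x" "of_real y" n] barabanov_pair_axioms unfolding m_def by blast
    define p q u v where "p = a * x + b * y" and "q = c * x + d * y"
      and "u = a * s + b * t" and "v = c * s + d * t"
    have p: "0 \<le> p" "0 \<le> q" "0 \<le> u" "0 \<le> v" unfolding p_def q_def u_def v_def using assms L by simp_all
    have Fpq: "F (of_real p) (of_real q) = r ^ n * m" using L(6) unfolding p_def q_def by simp
    have rn: "1 \<le> r ^ n" using r_gt1 by simp
    \<comment> \<open>The image of \<open>(x, y)\<close> does not shrink, which bounds
      \<open>p + q\<close> below uniformly in \<open>n\<close> and so keeps \<open>e\<close>
      bounded.\<close>
    have "m \<le> r ^ n * m" using rn \<open>m > 0\<close> by simp
    also have "\<dots> \<le> p * F 1 0 + q * F 0 1" using le_sum[of "of_real p" "of_real q"] Fpq p by simp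
    also have "\<dots> \<le> (p + q) * C" unfolding C_def using p nonneg by (simp add: algebra_simps)
    finally have pq: "m / C \<le> p + q" using \<open>C > 0\<close> by (simp add: field_simps)
    then have pq0: "0 < p + q" using \<open>m > 0\<close> \<open>C > 0\<close> by (smt (verit) divide_pos_pos)
    define D where "D = (a * d - b * c) * (s * y - t * x)"
    define e l where "e = D / (p + q)" and "l = (u + v) / (p + q)"
    have det: "u * q - v * p = D" unfolding D_def p_def q_def u_def v_def by (simp add: algebra_simps)
    have uv: "u = l * p + e" "v = l * q - e"
      using split_along[of p q u v D] pq0 det unfolding l_def e_def by simp_all
    have "l \<ge> 0" unfolding l_def using p pq0 by simp
    have "\<bar>D\<bar> \<le> \<bar>s * y - t * x\<bar>"
      unfolding D_def abs_mult using mult_right_mono[OF L(5), of "\<bar>s * y - t * x\<bar>"] by simp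
    then have "\<bar>e\<bar> \<le> \<bar>s * y - t * x\<bar> / (m / C)"
      unfolding e_def abs_divide using pq pq0 \<open>m > 0\<close> \<open>C > 0\<close> by (intro frac_le) auto
    then have eK: "\<bar>e\<bar> * F 1 (-1) \<le> K"
      unfolding K_def using mult_right_mono[OF _ nonneg] by fastforce
    \<comment> \<open>The vector \<open>(p + u, q + v)\<close> is \<open>1 + l\<close> times
      \<open>(p, q)\<close> plus \<open>e\<close> times \<open>(1, -1)\<close>. As
      \<open>l \<ge> 0\<close>, adding the image of \<open>(s, t)\<close> can lower the norm only by
      a bounded amount.\<close>
    have "r ^ n * m - \<bar>e\<bar> * F 1 (-1) \<le> (1 + l) * (r ^ n * m) - \<bar>e\<bar> * F 1 (-1)"
      using \<open>l \<ge> 0\<close> \<open>m > 0\<close> rn by (simp add: algebra_simps)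
    also have "\<dots> = F (of_real (1 + l) * of_real p) (of_real (1 + l) * of_real q) - F (of_real e * 1) (of_real e * (-1))"
      unfolding hom[of "of_real e"] using \<open>l \<ge> 0\<close> Fpq by (subst hom_real) simp_all
    also have "\<dots> \<le> F (of_real (p + u)) (of_real (q + v))"
      using triangle_diff[of "of_real (1 + l) * of_real p" "of_real (1 + l) * of_real q" "of_real e * 1" "of_real e * (-1)"]
      by (subst uv(1), subst uv(2)) (simp add: algebra_simps)
    also have "\<dots> \<le> r ^ n * F (of_real (x + s)) (of_real (y + t))"
      using G[of "of_real (x + s)" "of_real (y + t)"] unfolding p_def q_def u_def v_def
      by (simp add: algebra_simps)
    finally have "r ^ n * (m - F (of_real (x + s)) (of_real (y + t))) \<le> K" using eK by (simp add: algebra_simps)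
    then show ?thesis using rn by (simp add: pos_le_divide_eq mult.commute)
  qed
  moreover have "(\<lambda>n. K / r ^ n) \<longlonglongrightarrow> 0"
    using LIMSEQ_divide_realpow_zero[OF r_gt1] .
  ultimately have "m - F (of_real (x + s)) (of_real (y + t)) \<le> 0"
    using LIMSEQ_le_const by blast
  then show ?thesis unfolding m_def by simp
qed

text \<open>A product optimal for \<open>F\<close> at \<open>(x, y)\<close> sends this vector to a
  complex multiple of a cone vector plus a bounded error. The inequality holds for the cone vector,
  and the product expands \<open>G\<close> by at most \<open>r ^ n\<close>; dividing by
  \<open>r ^ n\<close> removes the error.\<close>

lemma le_extend:
  assumes G: "barabanov_pair \<alpha> r G" and "0 \<le> k"
    and le: "\<And>p q. 0 \<le> p \<Longrightarrow> 0 \<le> q \<Longrightarrow> F (of_real p) (of_real q) \<le> k * G (of_real p) (of_real q)"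
  shows "F x y \<le> k * G x y"
proof (cases "x = 0 \<and> y = 0")
  case True
  then show ?thesis using le[of 0 0] by simp
next
  case False
  interpret G: barabanov_pair \<alpha> r G by (fact G)
  define m where "m = F x y"
  have "m > 0" unfolding m_def using pos False by simp
  define C where "C = (F 1 0 + F 0 1) * (cmod x + cmod y)"
  have "C > 0" unfolding C_def using pos[of 1 0] pos[of 0 1] False
    by (metis add_pos_pos add_nonneg_pos add_pos_nonneg mult_pos_pos norm_ge_zero zero_less_norm_iff zero_neq_one)
  define K where "K = cmod (x - y) * C / m * (F 1 (-1) + k * G 1 (-1))"
  have "m - k * G x y \<le> K / r ^ n" for n
  proof -
    obtain a b c d :: real where L: "0 \<le> a" "0 \<le> b" "0 \<le> c" "0 \<le> d" "\<bar>a * d - b * c\<bar> \<le> 1"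
      "F (of_real a * x + of_real b * y) (of_real c * x + of_real d * y) = r ^ n * m"
      and Gn: "G (of_real a * x + of_real b * y) (of_real c * x + of_real d * y) \<le> r ^ n * G x y"
      using optimal_product[of x y n] G unfolding m_def by blast
    \<comment> \<open>The cone vector \<open>(p, q)\<close> is the image of
      \<open>(1, 1)\<close>.\<close>
    define p q where "p = a + b" and "q = c + d"
    define u v where "u = of_real a * x + of_real b * y" and "v = of_real c * x + of_real d * y"
    have p: "0 \<le> p" "0 \<le> q" unfolding p_def q_def using L by simp_all
    have rn: "1 \<le> r ^ n" using r_gt1 by simp
    have u: "cmod u \<le> p * (cmod x + cmod y)"
    proof -
      have "cmod u \<le> a * cmod x + b * cmod y"
        unfolding u_def using norm_triangle_ineq[of "of_real a * x" "of_real b * y"] L by (simp add: norm_mult)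
      also have "\<dots> \<le> p * (cmod x + cmod y)" unfolding p_def using L by (simp add: algebra_simps)
      finally show ?thesis .
    qed
    have v: "cmod v \<le> q * (cmod x + cmod y)"
    proof -
      have "cmod v \<le> c * cmod x + d * cmod y"
        unfolding v_def using norm_triangle_ineq[of "of_real c * x" "of_real d * y"] L by (simp add: norm_mult)
      also have "\<dots> \<le> q * (cmod x + cmod y)" unfolding q_def using L by (simp add: algebra_simps)
      finally show ?thesis .
    qed
    have "m \<le> r ^ n * m" using rn \<open>m > 0\<close> by simp
    also have "\<dots> \<le> cmod u * F 1 0 + cmod v * F 0 1" using le_sum[of u v] L(6) unfolding u_def v_def by simp
    also have "\<dots> \<le> p * (cmod x + cmod y) * F 1 0 + q * (cmod x + cmod y) * F 0 1"
      using u v nonneg by (intro add_mono mult_right_mono) auto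
    also have "\<dots> \<le> (p + q) * C" unfolding C_def using p nonneg by (simp add: algebra_simps)
    finally have pq: "m / C \<le> p + q" using \<open>C > 0\<close> by (simp add: field_simps)
    then have pq0: "0 < p + q" using \<open>m > 0\<close> \<open>C > 0\<close> by (smt (verit) divide_pos_pos)
    then have pqc: "(of_real p + of_real q :: complex) \<noteq> 0"
      by (metis of_real_add of_real_eq_0_iff less_irrefl)
    define D where "D = of_real (a * d - b * c) * (x - y)"
    define e l where "e = D / (of_real p + of_real q)" and "l = (u + v) / (of_real p + of_real q)"
    have det: "u * of_real q - v * of_real p = D"
      unfolding D_def p_def q_def u_def v_def by (simp add: algebra_simps)
    have uv: "u = l * of_real p + e * 1" "v = l * of_real q + e * (-1)"
      using split_along[OF pqc det] unfolding l_def e_def by simp_all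
    have "cmod D \<le> cmod (x - y)"
      unfolding D_def norm_mult norm_of_real using mult_right_mono[OF L(5), of "cmod (x - y)"] by simp
    moreover have "cmod (of_real p + of_real q) = p + q"
      using p by (metis abs_of_nonneg add_nonneg_nonneg norm_of_real of_real_add)
    ultimately have "cmod e \<le> cmod (x - y) / (m / C)"
      unfolding e_def norm_divide using pq pq0 \<open>m > 0\<close> \<open>C > 0\<close> by (intro frac_le) auto
    moreover have "0 \<le> F 1 (-1) + k * G 1 (-1)" using nonneg G.nonneg \<open>0 \<le> k\<close> by simp
    ultimately have eK: "cmod e * (F 1 (-1) + k * G 1 (-1)) \<le> K"
      unfolding K_def using mult_right_mono by fastforce
    have "r ^ n * m = F u v" using L(6) unfolding u_def v_def by simp
    also have "\<dots> \<le> cmod l * F (of_real p) (of_real q) + cmod e * F 1 (-1)"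
      by (subst uv(1), subst uv(2), rule order_trans[OF triangle]) (simp only: hom)
    also have "\<dots> \<le> k * (cmod l * G (of_real p) (of_real q)) + cmod e * F 1 (-1)"
      using mult_left_mono[OF le[OF p], of "cmod l"] by (simp add: mult.left_commute)
    also have "cmod l * G (of_real p) (of_real q) \<le> G u v + cmod e * G 1 (-1)"
      using G.triangle_diff[of "l * of_real p" "l * of_real q" "e * 1" "e * (-1)"]
      unfolding uv(1)[symmetric] uv(2)[symmetric] G.hom by simp
    then have "k * (cmod l * G (of_real p) (of_real q)) \<le> k * (r ^ n * G x y + cmod e * G 1 (-1))"
      using Gn \<open>0 \<le> k\<close> unfolding u_def v_def by (intro mult_left_mono) auto
    finally have "r ^ n * (m - k * G x y) \<le> K" using eK by (simp add: algebra_simps)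
    then show ?thesis using rn by (simp add: pos_le_divide_eq mult.commute)
  qed
  moreover have "(\<lambda>n. K / r ^ n) \<longlonglongrightarrow> 0"
    using LIMSEQ_divide_realpow_zero[OF r_gt1] .
  ultimately have "m - k * G x y \<le> 0"
    using LIMSEQ_le_const by blast
  then show ?thesis unfolding m_def by simp
qed

section \<open>Strict monotonicity and the threshold direction\<close>

lemma convex_slice:
  assumes "0 \<le> q" "q < q'"
  shows "q' * F 1 (of_real q) \<le> (q' - q) * F 1 0 + q * F 1 (of_real q')"
  using triangle[of "of_real (q' - q) * 1" "of_real q * 1" "of_real (q' - q) * 0" "of_real q * of_real q'"]
    hom_real[of "q' - q" 1 0] hom_real[of q 1 "of_real q'"] hom_real[of q' 1 "of_real q"] assms
  by (simp add: algebra_simps)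

text \<open>By convexity it suffices to compare with \<open>q = 0\<close>. At \<open>(1, 0)\<close>
  the optimal letter is \<open>\<alpha> A2\<close>, since \<open>A1\<close> fixes this vector and
  \<open>r > 1\<close>. If \<open>F 1 q'\<close> did not exceed \<open>F 1 0\<close>, applying
  \<open>\<alpha> A2\<close> would give \<open>F 1 (1 + q') \<le> F 1 1\<close>, hence
  \<open>F 1 1 \<le> F 1 0\<close> by convexity, and \<open>\<alpha> A2\<close> would not expand
  \<open>(1, 0)\<close>.\<close>

lemma strict_mono_slice:
  assumes "0 \<le> q" "q < q'"
  shows "F 1 (of_real q) < F 1 (of_real q')"
proof -
  have base: "F 1 0 < F 1 (of_real q')"
  proof (rule ccontr)
    assume "\<not> ?thesis"
    then have eq: "F 1 (of_real q') \<le> F 1 0" by simp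
    have F10: "0 < F 1 0" using pos[of 1 0] by simp
    have A: "r * F 1 0 = \<alpha> * F 1 1" using step[of 1 0] r_gt1 F10
      by (smt (verit) mult_less_cancel_right1 add.right_neutral)
    have "\<alpha> * F 1 (of_real (1 + q')) \<le> r * F 1 (of_real q')" using le2[of 1 "of_real q'"] by simp
    also have "\<dots> \<le> \<alpha> * F 1 1" unfolding A[symmetric] using eq r_gt1 by simp
    finally have B: "F 1 (of_real (1 + q')) \<le> F 1 1" using \<alpha>_pos by simp
    have "(1 + q') * F 1 1 \<le> q' * F 1 0 + F 1 (of_real (1 + q'))"
      using convex_slice[of 1 "1 + q'"] assms by simp
    then have "q' * F 1 1 \<le> q' * F 1 0" using B by (simp add: algebra_simps)
    then have "F 1 1 \<le> F 1 0" using assms by simp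
    then have "r * F 1 0 \<le> \<alpha> * F 1 0" unfolding A using \<alpha>_pos by simp
    then show False using r_gt1 \<alpha>_le1 F10 by simp
  qed
  have "q' * F 1 (of_real q) \<le> (q' - q) * F 1 0 + q * F 1 (of_real q')" by (rule convex_slice[OF assms])
  also have "\<dots> < (q' - q) * F 1 (of_real q') + q * F 1 (of_real q')"
    using base assms by simp
  finally show ?thesis using assms by (simp add: algebra_simps)
qed

text \<open>Directions in the cone are parametrised by \<open>p \<in> [0,1]\<close>; \<open>A\<^sub>1\<close> and \<open>A\<^sub>2\<close> act on them by
  \<open>p \<mapsto> 1 / (2 - p)\<close> and \<open>p \<mapsto> p / (1 + p)\<close>.\<close>
definition slice :: "real \<Rightarrow> real" where
  "slice p = F (of_real p) (of_real (1 - p))"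

text \<open>\<open>A1\<close> sends \<open>(p, 1 - p)\<close> to \<open>(1, 1 - p)\<close>, and
  \<open>A2\<close> sends it to \<open>(p, 1)\<close>. Both letters may be optimal at the same
  \<open>p\<close>.\<close>

definition first_optimal :: "real \<Rightarrow> bool" where
  "first_optimal p \<longleftrightarrow> F 1 (of_real (1 - p)) = r * slice p"

definition second_optimal :: "real \<Rightarrow> bool" where
  "second_optimal p \<longleftrightarrow> \<alpha> * F (of_real p) 1 = r * slice p"

lemma slice_pos: "0 < slice p"
  unfolding slice_def by (rule pos) auto

lemma slice_step: "r * slice p = max (F 1 (of_real (1 - p))) (\<alpha> * F (of_real p) 1)"
  unfolding slice_def step by simp

lemma cone_slice:
  assumes "0 < x + y"
  shows "F (of_real x) (of_real y) = (x + y) * slice (x / (x + y))"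
proof -
  have "(x + y) * slice (x / (x + y)) = F (of_real ((x + y) * (x / (x + y)))) (of_real ((x + y) * (1 - x / (x + y))))"
    unfolding slice_def of_real_mult using assms by (intro hom_real[symmetric]) simp
  moreover have "(x + y) * (x / (x + y)) = x" "(x + y) * (1 - x / (x + y)) = y"
    using assms by (simp_all add: field_simps)
  ultimately show ?thesis by simp
qed

lemma slice_first: "p \<le> 1 \<Longrightarrow> F 1 (of_real (1 - p)) = (2 - p) * slice (1 / (2 - p))"
  using cone_slice[of 1 "1 - p"] by simp

lemma slice_second: "0 \<le> p \<Longrightarrow> F (of_real p) 1 = (1 + p) * slice (p / (1 + p))"
  using cone_slice[of p 1] by (simp add: add.commute)

lemma continuous_on_slice: "continuous_on S slice"
proof (rule lipschitz_on_continuous_on[of "F 1 (-1)"], rule lipschitz_onI)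
  have "slice p - slice q \<le> \<bar>p - q\<bar> * F 1 (-1)" for p q
    using triangle[of "of_real q" "of_real (p - q) * 1" "of_real (1 - q)" "of_real (p - q) * (-1)"]
    unfolding hom slice_def norm_of_real by (simp add: algebra_simps)
  from this[of p q for p q] this[of q p for p q]
  show "dist (slice p) (slice q) \<le> F 1 (-1) * dist p q" for p q
    by (smt (verit) dist_real_def mult.commute)
qed (rule nonneg)

text \<open>As \<open>p\<close> grows, the value after \<open>\<alpha> A2\<close> does not decrease
  while the value after \<open>A1\<close> strictly decreases, so \<open>A1\<close> cannot become
  optimal again.\<close>

lemma threshold:
  assumes "0 \<le> p" "p < p'" "p' \<le> 1" "second_optimal p" "first_optimal p'"
  shows False
proof -
  have "F 1 (of_real (1 - p)) \<le> \<alpha> * F (of_real p) 1"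
    using assms(4) slice_step[of p] unfolding second_optimal_def by simp
  also have "\<dots> \<le> \<alpha> * F (of_real p') 1"
    using mono_cone[of p 1 "p' - p" 0] assms \<alpha>_pos by simp
  also have "\<dots> \<le> F 1 (of_real (1 - p'))"
    using assms(5) slice_step[of p'] unfolding first_optimal_def by simp
  also have "\<dots> < F 1 (of_real (1 - p))"
    using strict_mono_slice[of "1 - p'" "1 - p"] assms by simp
  finally show False by simp
qed

text \<open>At \<open>p = 1\<close> the letter \<open>A1\<close> fixes \<open>(1, 0)\<close>; in the
  next lemma \<open>\<alpha> A2\<close> scales \<open>(0, 1)\<close> by \<alpha>. Neither reaches
  the factor \<open>r > 1\<close>.\<close>

lemma not_first_optimal_1: "\<not> first_optimal 1"
  using r_gt1 pos[of 1 0] unfolding first_optimal_def slice_def by simp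

lemma not_second_optimal_0: "\<not> second_optimal 0"
  using r_gt1 \<alpha>_le1 pos[of 0 1] unfolding second_optimal_def slice_def by simp

end

subsection \<open>Uniqueness\<close>

text \<open>A closest pair of a point of \<open>P\<close> to the left of a point of \<open>Q\<close> must be separated by the
  threshold, as both maps are strict contractions; the same holds for a closest pair with the
  roles of \<open>P\<close> and \<open>Q\<close> exchanged. Two such pairs straddling the threshold yield a shorter pair
  on one side of it.\<close>
lemma threshold_invariant_sets_meet:
  fixes P Q :: "real set" and c1 c2 :: "real \<Rightarrow> bool"
  assumes compact: "compact P" "compact Q" and ne: "P \<noteq> {}" "Q \<noteq> {}"
    and sub: "P \<subseteq> {0..1}" "Q \<subseteq> {0..1}"
    and invP: "\<And>p. p \<in> P \<Longrightarrow> c1 p \<and> 1 / (2 - p) \<in> P \<or> c2 p \<and> p / (1 + p) \<in> P"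
    and invQ: "\<And>p. p \<in> Q \<Longrightarrow> c1 p \<and> 1 / (2 - p) \<in> Q \<or> c2 p \<and> p / (1 + p) \<in> Q"
    and threshold: "\<And>p p'. 0 \<le> p \<Longrightarrow> p < p' \<Longrightarrow> p' \<le> 1 \<Longrightarrow> c2 p \<Longrightarrow> \<not> c1 p'"
    and ends: "\<not> c1 1" "\<not> c2 0"
  shows "P \<inter> Q \<noteq> {}"
proof
  assume disj: "P \<inter> Q = {}"
  define f g :: "real \<Rightarrow> real" where "f p = 1 / (2 - p)" and "g p = p / (1 + p)" for p
  have contract: "f a < f b \<and> f b - f a < b - a" "g a < g b \<and> g b - g a < b - a"
    if "0 \<le> a" "a < b" "b \<le> 1" for a b
  proof -
    have *: "f b - f a = (b - a) / ((2 - a) * (2 - b))" "g b - g a = (b - a) / ((1 + a) * (1 + b))"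
      unfolding f_def g_def using that by (simp_all add: field_simps)
    have "1 * 1 < (2 - a) * (2 - b)" by (rule mult_less_le_imp_less) (use that in auto)
    moreover have "1 * 1 < (1 + a) * (1 + b)" by (rule mult_le_less_imp_less) (use that in auto)
    ultimately have "0 < f b - f a \<and> f b - f a < b - a" "0 < g b - g a \<and> g b - g a < b - a"
      unfolding * using that by (simp_all add: divide_less_eq)
    then show "f a < f b \<and> f b - f a < b - a" "g a < g b \<and> g b - g a < b - a" by auto
  qed
  define inv where "inv R \<longleftrightarrow> compact R \<and> R \<noteq> {} \<and> R \<subseteq> {0..1} \<and>
    (\<forall>p\<in>R. c1 p \<and> f p \<in> R \<or> c2 p \<and> g p \<in> R)" for R
  have inv: "inv P" "inv Q"
    unfolding inv_def f_def g_def using compact ne sub invP invQ by auto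
  \<comment> \<open>From its largest point \<open>R\<close> can only be continued by
    \<open>g\<close>, because \<open>f\<close> moves every point except 1 to the right, and
    \<open>g\<close> has values at most 1/2 on the unit interval. The mirror argument gives
    \<open>high\<close>; together they provide pairs in the prescribed order.\<close>
  have low: "\<exists>p\<in>R. p \<le> 1/2" if "inv R" for R
  proof -
    have R: "compact R" "R \<noteq> {}" "R \<subseteq> {0..1}" "\<forall>p\<in>R. c1 p \<and> f p \<in> R \<or> c2 p \<and> g p \<in> R"
      using that unfolding inv_def by auto
    obtain m where m: "m \<in> R" "\<And>p. p \<in> R \<Longrightarrow> p \<le> m"
      using compact_attains_sup[OF R(1,2)] by blast
    have m01: "0 \<le> m" "m \<le> 1" using m(1) R(3) by auto
    have "g m \<in> R"
    proof (rule ccontr)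
      assume "\<not> ?thesis"
      then have "c1 m" "f m \<in> R" using R(4) m(1) by auto
      then have "f m \<le> m" using m(2) by blast
      then have "(m - 1)\<^sup>2 \<le> 0" unfolding f_def using m01 by (simp add: field_simps power2_eq_square)
      then have "m = 1" by simp
      with \<open>c1 m\<close> ends show False by simp
    qed
    moreover have "g m \<le> 1/2" unfolding g_def using m01 by (simp add: field_simps)
    ultimately show ?thesis by blast
  qed
  have high: "\<exists>p\<in>R. 1/2 \<le> p" if "inv R" for R
  proof -
    have R: "compact R" "R \<noteq> {}" "R \<subseteq> {0..1}" "\<forall>p\<in>R. c1 p \<and> f p \<in> R \<or> c2 p \<and> g p \<in> R"
      using that unfolding inv_def by auto
    obtain m where m: "m \<in> R" "\<And>p. p \<in> R \<Longrightarrow> m \<le> p"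
      using compact_attains_inf[OF R(1,2)] by blast
    have m01: "0 \<le> m" "m \<le> 1" using m(1) R(3) by auto
    have "f m \<in> R"
    proof (rule ccontr)
      assume "\<not> ?thesis"
      then have "c2 m" "g m \<in> R" using R(4) m(1) by auto
      then have "m \<le> g m" using m(2) by blast
      then have "m\<^sup>2 \<le> 0" unfolding g_def using m01 by (simp add: field_simps power2_eq_square)
      then have "m = 0" by simp
      with \<open>c2 m\<close> ends show False by simp
    qed
    moreover have "1/2 \<le> f m" unfolding f_def using m01 by (simp add: field_simps)
    ultimately show ?thesis by blast
  qed
  have closest: "\<exists>a\<in>R. \<exists>b\<in>S. a < b \<and> c1 a \<and> f a \<in> R \<and> c2 b \<and> g b \<in> S \<and>
      (\<forall>a'\<in>R. \<forall>b'\<in>S. a' < b' \<longrightarrow> b - a \<le> b' - a')"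
    if "inv R" "inv S" "R \<inter> S = {}" for R S
  proof -
    have R: "compact R" "R \<subseteq> {0..1}" "\<And>p. p \<in> R \<Longrightarrow> c1 p \<and> f p \<in> R \<or> c2 p \<and> g p \<in> R"
      and S: "compact S" "S \<subseteq> {0..1}" "\<And>p. p \<in> S \<Longrightarrow> c1 p \<and> f p \<in> S \<or> c2 p \<and> g p \<in> S"
      using that unfolding inv_def by blast+
    \<comment> \<open>The weak inequality makes \<open>X\<close> compact; disjointness makes it
      strict at the minimiser.\<close>
    define X where "X = (R \<times> S) \<inter> {z. fst z \<le> snd z}"
    have "compact X" unfolding X_def
      by (intro compact_Int_closed compact_Times R S closed_Collect_le continuous_intros)
    moreover have "X \<noteq> {}"
      using low[OF that(1)] high[OF that(2)] unfolding X_def by force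
    moreover have "continuous_on X (\<lambda>z. snd z - fst z)" by (intro continuous_intros)
    ultimately obtain z where z: "z \<in> X" "\<And>z'. z' \<in> X \<Longrightarrow> snd z - fst z \<le> snd z' - fst z'"
      using continuous_attains_inf[of X "\<lambda>z. snd z - fst z"] by blast
    define a b where "a = fst z" and "b = snd z"
    have ab: "a \<in> R" "b \<in> S" "a \<le> b" using z(1) unfolding X_def a_def b_def by auto
    have "a < b" using ab that(3) by (metis IntI empty_iff less_le)
    have min: "b - a \<le> b' - a'" if "a' \<in> R" "b' \<in> S" "a' < b'" for a' b'
      using z(2)[of "(a', b')"] that unfolding X_def a_def b_def by auto
    have bounds: "0 \<le> a" "b \<le> 1" using ab R S by auto
    \<comment> \<open>Moving both points by the same map would give a closer pair, and the threshold
      forbids \<open>g\<close> on the left with \<open>f\<close> on the right.\<close>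
    have "\<not> (f a \<in> R \<and> f b \<in> S)" "\<not> (g a \<in> R \<and> g b \<in> S)"
      using contract[OF bounds(1) \<open>a < b\<close> bounds(2)] min[of "f a" "f b"] min[of "g a" "g b"] by auto
    moreover have "\<not> (c2 a \<and> c1 b)"
      using threshold[OF bounds(1) \<open>a < b\<close> bounds(2)] by blast
    ultimately show ?thesis
      using R(3)[OF ab(1)] S(3)[OF ab(2)] ab \<open>a < b\<close> min by blast
  qed
  obtain a b where ab: "a \<in> P" "b \<in> Q" "a < b" "c1 a" "f a \<in> P" "c2 b"
    and min: "\<And>a' b'. a' \<in> P \<Longrightarrow> b' \<in> Q \<Longrightarrow> a' < b' \<Longrightarrow> b - a \<le> b' - a'"
    using closest[OF inv disj] by blast
  obtain a' b' where ab': "a' \<in> Q" "b' \<in> P" "a' < b'" "c1 a'" "f a' \<in> Q" "c2 b'"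
    and min': "\<And>a b. a \<in> Q \<Longrightarrow> b \<in> P \<Longrightarrow> a < b \<Longrightarrow> b' - a' \<le> b - a"
    using closest[OF inv(2,1)] disj by blast
  have bounds: "0 \<le> a" "a \<le> 1" "0 \<le> b" "b \<le> 1" "0 \<le> a'" "a' \<le> 1" "0 \<le> b'" "b' \<le> 1"
    using ab ab' sub by auto
  have "a' \<le> b" using threshold[of b a'] bounds ab ab' by force
  have "a \<le> b'" using threshold[of b' a] bounds ab ab' by force
  have "a \<noteq> a'" using ab ab' disj by auto
  \<comment> \<open>Applying \<open>f\<close> to \<open>a\<close> and \<open>a'\<close> stays in
    \<open>P\<close> and \<open>Q\<close> and shortens their distance. If \<open>a < a'\<close>,
    then \<open>a' \<le> b\<close> makes the new pair shorter than the minimal \<open>b - a\<close>;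
    otherwise \<open>a \<le> b'\<close> contradicts minimality of \<open>b' - a'\<close>.\<close>
  then consider "a < a'" | "a' < a" by linarith
  then show False
  proof cases
    case 1
    then show False using contract(1)[of a a'] min[OF ab(5) ab'(5)] bounds \<open>a' \<le> b\<close> by auto
  next
    case 2
    then show False using contract(1)[of a' a] min'[OF ab'(5) ab(5)] bounds \<open>a \<le> b'\<close> by auto
  qed
qed

text \<open>For a letter optimal for \<open>F\<close> at a contact direction, the value of
  \<open>F\<close> after the letter is at most \<open>k\<close> times that of \<open>G\<close>,
  which is at most \<open>k * r * G.slice p\<close>, equal to the value of \<open>F\<close>.
  Equality throughout makes the letter optimal for \<open>G\<close> and preserves contact.\<close>

lemma contact_step:
  assumes F: "barabanov_pair \<alpha> r F" and G: "barabanov_pair \<alpha> r G" and p: "0 \<le> p" "p \<le> 1"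
    and k: "0 < k"
    and le: "\<And>q. 0 \<le> q \<Longrightarrow> q \<le> 1 \<Longrightarrow> barabanov_pair.slice F q \<le> k * barabanov_pair.slice G q"
    and eq: "barabanov_pair.slice F p = k * barabanov_pair.slice G p"
  shows "barabanov_pair.first_optimal r F p \<and> barabanov_pair.first_optimal r G p \<and>
      barabanov_pair.slice F (1 / (2 - p)) = k * barabanov_pair.slice G (1 / (2 - p)) \<or>
    barabanov_pair.second_optimal \<alpha> r F p \<and> barabanov_pair.second_optimal \<alpha> r G p \<and>
      barabanov_pair.slice F (p / (1 + p)) = k * barabanov_pair.slice G (p / (1 + p))"
proof -
  interpret F: barabanov_pair \<alpha> r F by fact
  interpret G: barabanov_pair \<alpha> r G by fact
  consider "F.first_optimal p" | "F.second_optimal p"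
    using F.slice_step[of p] unfolding F.first_optimal_def F.second_optimal_def by (metis max_def)
  then show ?thesis
  proof cases
    case 1
    have "F 1 (of_real (1 - p)) \<le> k * G 1 (of_real (1 - p))"
      unfolding F.slice_first[OF p(2)] G.slice_first[OF p(2)]
      using mult_left_mono[OF le[of "1 / (2 - p)"], of "2 - p"] p by (simp add: mult.left_commute)
    moreover have "k * G 1 (of_real (1 - p)) \<le> k * (r * G.slice p)"
      using G.slice_step[of p] k by simp
    moreover have "F 1 (of_real (1 - p)) = k * (r * G.slice p)"
      using 1 eq unfolding F.first_optimal_def by simp
    ultimately have *: "F 1 (of_real (1 - p)) = k * G 1 (of_real (1 - p))" "G.first_optimal p"
      unfolding G.first_optimal_def using k by auto
    then have "F.slice (1 / (2 - p)) = k * G.slice (1 / (2 - p))"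
      unfolding F.slice_first[OF p(2)] G.slice_first[OF p(2)] using p by simp
    with * 1 show ?thesis by blast
  next
    case 2
    have "\<alpha> * F (of_real p) 1 \<le> k * (\<alpha> * G (of_real p) 1)"
      unfolding F.slice_second[OF p(1)] G.slice_second[OF p(1)]
      using mult_left_mono[OF le[of "p / (1 + p)"], of "1 + p"] p F.\<alpha>_pos by (simp add: mult.left_commute)
    moreover have "k * (\<alpha> * G (of_real p) 1) \<le> k * (r * G.slice p)"
      using G.slice_step[of p] k by simp
    moreover have "\<alpha> * F (of_real p) 1 = k * (r * G.slice p)"
      using 2 eq unfolding F.second_optimal_def by simp
    ultimately have *: "\<alpha> * F (of_real p) 1 = k * (\<alpha> * G (of_real p) 1)" "G.second_optimal p"
      unfolding G.second_optimal_def using k by auto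
    then have "F.slice (p / (1 + p)) = k * G.slice (p / (1 + p))"
      unfolding F.slice_second[OF p(1)] G.slice_second[OF p(1)] using p F.\<alpha>_pos by simp
    with * 2 show ?thesis by blast
  qed
qed

lemma barabanov_pair_unique:
  assumes F: "barabanov_pair \<alpha> r F" and G: "barabanov_pair \<alpha> r G"
  shows "\<exists>k>0. \<forall>x y. F x y = k * G x y"
proof -
  interpret F: barabanov_pair \<alpha> r F by fact
  interpret G: barabanov_pair \<alpha> r G by fact
  define \<phi> where "\<phi> p = F.slice p / G.slice p" for p
  have cont: "continuous_on {0..1} \<phi>"
    unfolding \<phi>_def using G.slice_pos
    by (intro continuous_on_divide F.continuous_on_slice G.continuous_on_slice) (metis less_irrefl)
  obtain pmax where pmax: "pmax \<in> {0..1}" "\<And>p. p \<in> {0..1} \<Longrightarrow> \<phi> p \<le> \<phi> pmax"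
    using continuous_attains_sup[OF _ _ cont] by auto
  obtain pmin where pmin: "pmin \<in> {0..1}" "\<And>p. p \<in> {0..1} \<Longrightarrow> \<phi> pmin \<le> \<phi> p"
    using continuous_attains_inf[OF _ _ cont] by auto
  define k j where "k = \<phi> pmax" and "j = \<phi> pmin"
  have "j > 0" "k > 0" unfolding j_def k_def \<phi>_def using F.slice_pos G.slice_pos by simp_all
  have F_le: "F.slice p \<le> k * G.slice p" if "0 \<le> p" "p \<le> 1" for p
    using pmax(2)[of p] that G.slice_pos[of p] unfolding k_def[symmetric] by (simp add: \<phi>_def divide_le_eq)
  have G_le: "G.slice p \<le> (1 / j) * F.slice p" if "0 \<le> p" "p \<le> 1" for p
    using pmin(2)[of p] that G.slice_pos[of p] \<open>j > 0\<close> unfolding j_def[symmetric] by (simp add: \<phi>_def field_simps)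
  define P where "P = {0..1} \<inter> {p. F.slice p = k * G.slice p}"
  \<comment> \<open>Minimality of the ratio is written as contact of \<open>G\<close> with a
    multiple of \<open>F\<close>, so \<open>contact_step\<close> applies with the roles
    exchanged.\<close>
  define Q where "Q = {0..1} \<inter> {p. G.slice p = (1 / j) * F.slice p}"
  have compact: "compact P" "compact Q"
    unfolding P_def Q_def
    by (intro compact_Int_closed closed_Collect_eq continuous_intros compact_Icc
        F.continuous_on_slice G.continuous_on_slice)+
  have "P \<inter> Q \<noteq> {}"
  \<comment> \<open>The letters found are optimal for both norms, so the threshold of
    \<open>F\<close> governs both \<open>P\<close> and \<open>Q\<close>.\<close>
  proof (rule threshold_invariant_sets_meet[OF compact, of F.first_optimal F.second_optimal])
    show "P \<noteq> {}" "Q \<noteq> {}"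
      using pmax(1) pmin(1) F.slice_pos[of pmin] G.slice_pos[of pmax] G.slice_pos[of pmin]
      by (auto simp: P_def Q_def k_def j_def \<phi>_def)
    show "P \<subseteq> {0..1}" "Q \<subseteq> {0..1}" by (auto simp: P_def Q_def)
    fix p :: real
    have img: "1 / (2 - p) \<in> {0..1}" "p / (1 + p) \<in> {0..1}" if "p \<in> {0..1}"
      using that by (auto simp: field_simps)
    show "F.first_optimal p \<and> 1 / (2 - p) \<in> P \<or> F.second_optimal p \<and> p / (1 + p) \<in> P" if "p \<in> P"
      using contact_step[OF F G _ _ \<open>k > 0\<close> F_le] img that unfolding P_def by auto
    show "F.first_optimal p \<and> 1 / (2 - p) \<in> Q \<or> F.second_optimal p \<and> p / (1 + p) \<in> Q" if "p \<in> Q"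
      using contact_step[OF G F _ _ _ G_le] img that \<open>j > 0\<close> unfolding Q_def by auto
  next
    show "\<not> F.first_optimal p'" if "0 \<le> p" "p < p'" "p' \<le> 1" "F.second_optimal p" for p p'
      using F.threshold that by blast
  qed (rule F.not_first_optimal_1 F.not_second_optimal_0)+
  then obtain p where "F.slice p = k * G.slice p" "G.slice p = (1 / j) * F.slice p"
    unfolding P_def Q_def by blast
  then have "j = k" using F.slice_pos[of p] G.slice_pos[of p] \<open>j > 0\<close> by (simp add: field_simps)
  have cone: "F (of_real x) (of_real y) = k * G (of_real x) (of_real y)" if "0 \<le> x" "0 \<le> y" for x y
  proof (cases "x + y = 0")
    case True
    then have "x = 0" "y = 0" using that by auto
    then show ?thesis using F.hom[of 0 0 0] G.hom[of 0 0 0] by simp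
  next
    case False
    then have "0 < x + y" using that by simp
    moreover have "0 \<le> x / (x + y)" "x / (x + y) \<le> 1" using that calculation by (auto simp: field_simps)
    then have "F.slice (x / (x + y)) = k * G.slice (x / (x + y))"
      using F_le[of "x / (x + y)"] G_le[of "x / (x + y)"] \<open>j > 0\<close> \<open>j = k\<close> by (simp add: field_simps)
    ultimately show ?thesis using F.cone_slice G.cone_slice by simp
  qed
  have "F x y \<le> k * G x y" for x y
    using F.le_extend[OF G, of k] cone \<open>k > 0\<close> by simp
  moreover have "G x y \<le> 1 / k * F x y" for x y
    using G.le_extend[OF F, of "1 / k"] cone \<open>k > 0\<close> by simp
  ultimately show ?thesis using \<open>k > 0\<close>
    by (intro exI[of _ k]) (simp add: field_simps order_antisym)
qed

subsection \<open>Existence\<close>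

text \<open>A two-sided Fekete argument: \<open>a\<close> is submultiplicative and
  \<open>\<delta> * a\<close> supermultiplicative, so the supremum of the roots of
  \<open>\<delta> * a n\<close> lies below every root of \<open>a n\<close>.\<close>

lemma quasi_multiplicative_growth:
  fixes a :: "nat \<Rightarrow> real"
  assumes pos: "\<And>n. 0 < a n" and \<delta>: "0 < \<delta>"
    and sub: "\<And>m n. a (m + n) \<le> a m * a n"
    and super: "\<And>m n. \<delta> * (a m * a n) \<le> a (m + n)"
  shows "\<exists>r>0. \<forall>n. r ^ n \<le> a n \<and> \<delta> * a n \<le> r ^ n"
proof -
  have lower: "(\<delta> * a m) ^ Suc n \<le> \<delta> * a (Suc n * m)" for m n
  proof (induction n)
    case (Suc n)
    have "(\<delta> * a m) ^ Suc (Suc n) \<le> (\<delta> * a m) * (\<delta> * a (Suc n * m))"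
      using Suc pos[of m] \<delta> by (simp add: mult_left_mono)
    also have "\<dots> = \<delta> * (\<delta> * (a m * a (Suc n * m)))" by simp
    also have "\<dots> \<le> \<delta> * a (m + Suc n * m)" using super \<delta> by (intro mult_left_mono) auto
    finally show ?case by simp
  qed simp
  have upper: "a (Suc n * m) \<le> a m ^ Suc n" for m n
  proof (induction n)
    case (Suc n)
    have "a (m + Suc n * m) \<le> a m * a (Suc n * m)" by (rule sub)
    also have "\<dots> \<le> a m * a m ^ Suc n" using Suc pos[of m] by (simp add: mult_left_mono)
    finally show ?case by simp
  qed simp
  have "\<delta> * (a 0 * a 0) \<le> a 0" "a 0 \<le> a 0 * a 0" using super[of 0 0] sub[of 0 0] by simp_all
  then have zero: "1 \<le> a 0" "\<delta> * a 0 \<le> 1"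
    using pos[of 0] by (simp_all add: mult.assoc[symmetric])
  have "\<delta> * 1 \<le> \<delta> * a 0" using zero(1) \<delta> by (intro mult_left_mono) auto
  then have "\<delta> \<le> 1" using zero(2) by linarith
  \<comment> \<open>Both estimates are compared at the common index
    \<open>Suc n * m\<close>.\<close>
  have cross: "(\<delta> * a m) ^ Suc n \<le> a (Suc n) ^ m" if "0 < m" for m n
  proof -
    from that obtain m' where m: "m = Suc m'" by (cases m) auto
    have "(\<delta> * a m) ^ Suc n \<le> \<delta> * a (Suc n * m)" by (rule lower)
    also have "\<dots> \<le> a (m * Suc n)"
      using \<open>\<delta> \<le> 1\<close> pos[of "m * Suc n"] by (simp add: mult.commute)
    also have "\<dots> \<le> a (Suc n) ^ m" unfolding m by (rule upper)
    finally show ?thesis .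
  qed
  \<comment> \<open>Indices are shifted by one to avoid the zeroth root; length 0 is settled by
    \<open>zero\<close>.\<close>
  define R where "R m = root (Suc m) (\<delta> * a (Suc m))" for m
  have R: "0 < R m" "R m ^ Suc m = \<delta> * a (Suc m)" for m
    unfolding R_def using pos[of "Suc m"] \<delta> by (simp_all del: power_Suc)
  have R_le: "R m \<le> root (Suc n) (a (Suc n))" for m n
  proof -
    have "R m ^ (Suc m * Suc n) \<le> root (Suc n) (a (Suc n)) ^ (Suc m * Suc n)"
    proof -
      have "R m ^ (Suc m * Suc n) = (\<delta> * a (Suc m)) ^ Suc n" by (simp only: power_mult R(2))
      also have "\<dots> \<le> a (Suc n) ^ Suc m" by (rule cross) simp
      also have "\<dots> = root (Suc n) (a (Suc n)) ^ (Suc m * Suc n)"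
        unfolding mult.commute[of "Suc m"] power_mult using pos[of "Suc n"]
        by (simp only: real_root_pow_pos zero_less_Suc)
      finally show ?thesis .
    qed
    then show ?thesis
      using pos[of "Suc n"] by (subst (asm) power_mono_iff) (auto simp: R(1) less_imp_le)
  qed
  define r where "r = (SUP m. R m)"
  have bdd: "bdd_above (range R)" using R_le[of _ 0] by (intro bdd_aboveI2[where M = "a 1"]) simp
  have "R m \<le> r" for m unfolding r_def using bdd by (intro cSUP_upper) auto
  then have "0 < r" using R(1)[of 0] by (meson less_le_trans)
  have "r ^ n \<le> a n \<and> \<delta> * a n \<le> r ^ n" for n
  proof (cases n)
    case (Suc m)
    have "r \<le> root n (a n)" unfolding r_def Suc by (rule cSUP_least) (use R_le in auto)
    then have "r ^ n \<le> root n (a n) ^ n" using \<open>0 < r\<close> by (intro power_mono) auto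
    also have "\<dots> = a n" using pos[of n] Suc by (simp del: power_Suc)
    finally have "r ^ n \<le> a n" .
    moreover have "\<delta> * a n = R m ^ n" using R(2) Suc by simp
    then have "\<delta> * a n \<le> r ^ n" using \<open>R m \<le> r\<close> R(1)[of m] by (simp add: power_mono)
    ultimately show ?thesis by simp
  qed (use zero in simp)
  then show ?thesis using \<open>0 < r\<close> by blast
qed

text \<open>The largest \<open>\<ell>\<^sup>1\<close>-norm of the image of \<open>(x, y)\<close> under a product of length \<open>n\<close>.\<close>
primrec growth :: "real \<Rightarrow> nat \<Rightarrow> complex \<Rightarrow> complex \<Rightarrow> real" where
  "growth \<alpha> 0 x y = cmod x + cmod y"
| "growth \<alpha> (Suc n) x y = max (growth \<alpha> n (x + y) y) (\<alpha> * growth \<alpha> n x (x + y))"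

section \<open>Maximal growth of products and the limiting norm\<close>

context
  fixes \<alpha> :: real
  assumes \<alpha>: "0 < \<alpha>" "\<alpha> \<le> 1"
begin

lemma growth_nonneg: "0 \<le> growth \<alpha> n x y"
  by (induction n arbitrary: x y) (auto simp: le_max_iff_disj)

lemma growth_hom: "growth \<alpha> n (c * x) (c * y) = cmod c * growth \<alpha> n x y"
proof (induction n arbitrary: x y)
  case (Suc n)
  show ?case
    using Suc[of "x + y" y] Suc[of x "x + y"]
    by (simp add: max_mult_distrib_left mult.left_commute flip: distrib_left)
qed (simp add: norm_mult distrib_left)

lemma growth_triangle: "growth \<alpha> n (x + x') (y + y') \<le> growth \<alpha> n x y + growth \<alpha> n x' y'"
proof (induction n arbitrary: x y x' y')
  case 0
  show ?case using norm_triangle_ineq[of x x'] norm_triangle_ineq[of y y'] by simp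
next
  case (Suc n)
  have "growth \<alpha> n (x + x' + (y + y')) (y + y') \<le> growth \<alpha> (Suc n) x y + growth \<alpha> (Suc n) x' y'"
    using Suc[of "x + y" "x' + y'" y y'] by (simp add: algebra_simps)
  moreover have "\<alpha> * growth \<alpha> n (x + x') (x + x' + (y + y')) \<le> \<alpha> * growth \<alpha> n x (x + y) + \<alpha> * growth \<alpha> n x' (x' + y')"
    using mult_left_mono[OF Suc[of x x' "x + y" "x' + y'"], of \<alpha>] \<alpha> by (simp add: algebra_simps)
  then have "\<alpha> * growth \<alpha> n (x + x') (x + x' + (y + y')) \<le> growth \<alpha> (Suc n) x y + growth \<alpha> (Suc n) x' y'"
    by simp
  ultimately show ?case by simp
qed

text \<open>Both letters have nonnegative entries, so moduli of images are bounded by images of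
  moduli.\<close>

lemma growth_dominated:
  assumes "cmod x \<le> s" "cmod y \<le> t"
  shows "growth \<alpha> n x y \<le> growth \<alpha> n (of_real s) (of_real t)"
  using assms
proof (induction n arbitrary: x y s t)
  case (Suc n)
  have "cmod (x + y) \<le> s + t" using norm_triangle_ineq[of x y] Suc.prems by simp
  then show ?case
    using Suc.IH[of "x + y" "s + t" y t] Suc.IH[of x s "x + y" "s + t"] Suc.prems \<alpha>
    unfolding growth.simps(2) of_real_add[symmetric] by (intro max.mono mult_left_mono) auto
qed auto

text \<open>For a nonnegative matrix, the sum norm of the image of \<open>(1, 1)\<close> is the sum
  of all entries, so \<open>total\<close> is a matrix norm maximised over products of length
  \<open>n\<close>.\<close>

abbreviation total :: "nat \<Rightarrow> real" where "total n \<equiv> growth \<alpha> n 1 1"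

lemma growth_le_total: "growth \<alpha> n x y \<le> (cmod x + cmod y) * total n"
  using growth_dominated[of x "cmod x + cmod y" y "cmod x + cmod y" n]
    growth_hom[of n "of_real (cmod x + cmod y)" 1 1] by (simp del: of_real_add)

lemma growth_add_le: "growth \<alpha> (n + m) x y \<le> growth \<alpha> m x y * total n"
proof (induction m arbitrary: x y)
  case (Suc m)
  have "growth \<alpha> (n + m) (x + y) y \<le> growth \<alpha> (Suc m) x y * total n"
    using Suc[of "x + y" y] by (rule order_trans) (simp add: mult_right_mono growth_nonneg)
  moreover have "\<alpha> * growth \<alpha> (n + m) x (x + y) \<le> (\<alpha> * growth \<alpha> m x (x + y)) * total n"
    using mult_left_mono[OF Suc[of x "x + y"], of \<alpha>] \<alpha> by (simp add: mult.assoc)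
  then have "\<alpha> * growth \<alpha> (n + m) x (x + y) \<le> growth \<alpha> (Suc m) x y * total n"
    by (rule order_trans) (simp add: mult_right_mono growth_nonneg)
  ultimately show ?case by simp
qed (use growth_le_total in simp)

text \<open>The extra letter is charged to the last position, where it at most doubles the sum
  norm.\<close>

lemma growth_Suc_le: "growth \<alpha> (Suc n) x y \<le> 2 * growth \<alpha> n x y"
proof (induction n arbitrary: x y)
  case 0
  have "\<alpha> * (cmod x + cmod (x + y)) \<le> 1 * (cmod x + cmod (x + y))"
    using \<alpha> by (intro mult_right_mono) auto
  moreover have "cmod (x + y) \<le> cmod x + cmod y" by (rule norm_triangle_ineq)
  ultimately show ?case unfolding growth.simps by (smt (verit) norm_ge_zero)
next
  case (Suc n)
  have "\<alpha> * growth \<alpha> (Suc n) x (x + y) \<le> 2 * (\<alpha> * growth \<alpha> n x (x + y))"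
    using mult_left_mono[OF Suc[of x "x + y"], of \<alpha>] \<alpha> by simp
  then show ?case using Suc[of "x + y" y]
    unfolding growth.simps(2)[of \<alpha> "Suc n" x y] growth.simps(2)[of \<alpha> n x y]
    by (simp add: max_mult_distrib_left del: growth.simps) (auto simp: le_max_iff_disj simp del: growth.simps)
qed

text \<open>The two extra letters \<open>\<alpha> A\<^sub>1 A\<^sub>2\<close> form a matrix with entries at least \<open>\<alpha>\<close>.\<close>
lemma growth_add_ge:
  "0 \<le> x \<Longrightarrow> 0 \<le> y \<Longrightarrow>
    \<alpha> * growth \<alpha> m (of_real x) (of_real y) * total n \<le> growth \<alpha> (n + 2 + m) (of_real x) (of_real y)"
proof (induction m arbitrary: x y)
  case 0
  have "(x + y) * total n = growth \<alpha> n (of_real (x + y)) (of_real (x + y))"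
    using growth_hom[of n "of_real (x + y)" 1 1] 0 by (simp del: of_real_add)
  also have "\<dots> \<le> growth \<alpha> n (of_real (x + (x + y))) (of_real (x + y))"
    by (rule growth_dominated) (use 0 in \<open>simp_all del: of_real_add\<close>)
  also have "\<dots> \<le> growth \<alpha> (Suc n) (of_real x) (of_real (x + y))" by simp
  finally have "\<alpha> * ((x + y) * total n) \<le> \<alpha> * growth \<alpha> (Suc n) (of_real x) (of_real (x + y))"
    using \<alpha> by simp
  also have "\<dots> \<le> growth \<alpha> (Suc (Suc n)) (of_real x) (of_real y)" by simp
  finally show ?case using 0 by simp
next
  case (Suc m)
  have "\<alpha> * growth \<alpha> m (of_real (x + y)) (of_real y) * total n
      \<le> growth \<alpha> (n + 2 + m) (of_real (x + y)) (of_real y)"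
    using Suc.prems by (intro Suc.IH) auto
  moreover have "\<alpha> * (\<alpha> * growth \<alpha> m (of_real x) (of_real (x + y)) * total n)
      \<le> \<alpha> * growth \<alpha> (n + 2 + m) (of_real x) (of_real (x + y))"
    using Suc.IH[of x "x + y"] Suc.prems \<alpha> by (intro mult_left_mono) auto
  ultimately have "max (\<alpha> * growth \<alpha> m (of_real (x + y)) (of_real y) * total n)
      (\<alpha> * (\<alpha> * growth \<alpha> m (of_real x) (of_real (x + y)) * total n))
    \<le> growth \<alpha> (Suc (n + 2 + m)) (of_real x) (of_real y)"
    unfolding growth.simps(2)[of \<alpha> "n + 2 + m"] of_real_add by (rule max.mono)
  moreover have "max (\<alpha> * u * t) (\<alpha> * (\<alpha> * v * t)) = \<alpha> * max u (\<alpha> * v) * t" if "0 \<le> t" for u v t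
    using \<alpha> that by (simp add: max_mult_distrib_left max_mult_distrib_right mult_ac)
  note this[OF growth_nonneg]
  ultimately show ?case
    unfolding growth.simps(2)[of \<alpha> m] of_real_add[symmetric] add_Suc_right by simp
qed

lemma total_ge: "2 \<le> total n"
proof (induction n)
  case (Suc n)
  have "total n \<le> growth \<alpha> n (of_real 2) (of_real 1)"
    by (rule growth_dominated) auto
  then show ?case using Suc by simp
qed simp

text \<open>The \<alpha> comes from the two connecting letters in \<open>growth_add_ge\<close>;
  removing them again costs a factor 2 each, hence 4.\<close>

lemma total_growth: "\<exists>r>0. \<forall>n. r ^ n \<le> total n \<and> \<alpha> / 4 * total n \<le> r ^ n"
proof (rule quasi_multiplicative_growth)
  show "0 < total n" for n using total_ge[of n] by simp
  show "0 < \<alpha> / 4" using \<alpha> by simp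
  show "total (m + n) \<le> total m * total n" for m n
    using growth_add_le[of m n 1 1] by (simp add: mult.commute)
  show "\<alpha> / 4 * (total m * total n) \<le> total (m + n)" for m n
  proof -
    have "\<alpha> * total n * total m \<le> growth \<alpha> (m + 2 + n) 1 1"
      using growth_add_ge[of 1 1 n m] by (simp del: growth.simps)
    also have "m + 2 + n = Suc (Suc (m + n))" by simp
    also have "growth \<alpha> (Suc (Suc (m + n))) 1 1 \<le> 4 * total (m + n)"
      using growth_Suc_le[of "Suc (m + n)" 1 1] growth_Suc_le[of "m + n" 1 1] by linarith
    finally show ?thesis by (simp add: field_simps)
  qed
qed

text \<open>The quotients \<open>f\<close> satisfy a one-step recursion in \<open>n\<close>, but
  need not converge. Their limit superior does satisfy the Barabanov equation, and
  \<open>f_one\<close> keeps it nonzero.\<close>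

lemma barabanov_pair_exists: "\<exists>r F. barabanov_pair \<alpha> r F"
proof -
  obtain r where r: "0 < r" "\<And>n. r ^ n \<le> total n" "\<And>n. \<alpha> / 4 * total n \<le> r ^ n"
    using total_growth by metis
  define f where "f n x y = growth \<alpha> n x y / r ^ n" for n x y
  have f_nonneg: "0 \<le> f n x y" for n x y unfolding f_def using growth_nonneg r by simp
  have f_le: "f n x y \<le> 4 / \<alpha> * (cmod x + cmod y)" for n x y
  proof -
    have "total n \<le> 4 / \<alpha> * r ^ n" using r(3)[of n] \<alpha> by (simp add: field_simps)
    then have "growth \<alpha> n x y \<le> (cmod x + cmod y) * (4 / \<alpha> * r ^ n)"
      using growth_le_total[of n x y] by (meson add_nonneg_nonneg mult_left_mono norm_ge_zero order_trans)
    then show ?thesis unfolding f_def using r by (simp add: divide_le_eq mult_ac)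
  qed
  have f_hom: "f n (c * x) (c * y) = cmod c * f n x y" for n c x y
    unfolding f_def growth_hom by simp
  have f_tri: "f n (x + x') (y + y') \<le> f n x y + f n x' y'" for n x x' y y'
    unfolding f_def add_divide_distrib[symmetric] using growth_triangle r by (simp add: divide_right_mono)
  have f_step: "r * f (Suc n) x y = max (f n (x + y) y) (\<alpha> * f n x (x + y))" for n x y
    unfolding f_def using r by (simp add: max_mult_distrib_left max_divide_distrib_right)
  have f_one: "1 \<le> f n 1 1" for n unfolding f_def using r by simp
  \<comment> \<open>Tail suprema decrease in \<open>n\<close>, so they converge, and they inherit
    the recursion exactly because a supremum commutes with the maximum of two terms.\<close>
  define W where "W n x y = (SUP m. f (n + m) x y)" for n x y
  have bdd: "bdd_above (range (\<lambda>m. f (n + m) x y))" for n x y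
    using f_le by (intro bdd_aboveI2) blast
  have W_ge: "f (n + m) x y \<le> W n x y" for n m x y
    unfolding W_def using bdd by (intro cSUP_upper) auto
  have W_leI: "W n x y \<le> B" if "\<And>m. f (n + m) x y \<le> B" for n x y B
    unfolding W_def using that by (intro cSUP_least) auto
  have W_nonneg: "0 \<le> W n x y" for n x y using W_ge[of n 0] f_nonneg by (meson order_trans)
  have W_dec: "decseq (\<lambda>n. W n x y)" for x y
  proof (rule decseq_SucI, rule W_leI)
    show "f (Suc n + m) x y \<le> W n x y" for n m using W_ge[of n "Suc m"] by simp
  qed
  have W_step: "r * W (Suc n) x y = max (W n (x + y) y) (\<alpha> * W n x (x + y))" for n x y
  proof (rule antisym)
    have "W (Suc n) x y \<le> max (W n (x + y) y) (\<alpha> * W n x (x + y)) / r"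
    proof (rule W_leI)
      fix m
      have "r * f (Suc n + m) x y \<le> max (W n (x + y) y) (\<alpha> * W n x (x + y))"
        unfolding add_Suc f_step using W_ge \<alpha> by (intro max.mono mult_left_mono) auto
      then show "f (Suc n + m) x y \<le> max (W n (x + y) y) (\<alpha> * W n x (x + y)) / r"
        using r by (simp add: le_divide_eq mult.commute)
    qed
    then show "r * W (Suc n) x y \<le> max (W n (x + y) y) (\<alpha> * W n x (x + y))"
      using r by (simp add: le_divide_eq mult.commute)
    have le: "r * f (Suc (n + m)) x y \<le> r * W (Suc n) x y" for m
      using W_ge[of "Suc n" m] r by simp
    have "W n (x + y) y \<le> r * W (Suc n) x y"
    proof (rule W_leI)
      show "f (n + m) (x + y) y \<le> r * W (Suc n) x y" for m
        by (rule order_trans[OF _ le[of m]]) (simp add: f_step)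
    qed
    moreover have "W n x (x + y) \<le> r * W (Suc n) x y / \<alpha>"
    proof (rule W_leI)
      fix m
      have "\<alpha> * f (n + m) x (x + y) \<le> r * W (Suc n) x y"
        by (rule order_trans[OF _ le[of m]]) (simp add: f_step)
      then show "f (n + m) x (x + y) \<le> r * W (Suc n) x y / \<alpha>"
        using \<alpha> by (simp add: le_divide_eq mult.commute)
    qed
    ultimately show "max (W n (x + y) y) (\<alpha> * W n x (x + y)) \<le> r * W (Suc n) x y"
      using \<alpha> by (simp add: le_divide_eq mult.commute)
  qed
  define F where "F x y = lim (\<lambda>n. W n x y)" for x y
  have W_lim: "(\<lambda>n. W n x y) \<longlonglongrightarrow> F x y" for x y
  proof -
    have "convergent (\<lambda>n. W n x y)"
      by (rule decseq_convergent[OF W_dec[of x y], of 0]) (auto simp: W_nonneg convergent_def)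
    then show ?thesis unfolding F_def convergent_LIMSEQ_iff .
  qed
  have F_nonneg: "0 \<le> F x y" for x y
    using LIMSEQ_le_const[OF W_lim] W_nonneg by blast
  have F_hom_le: "F (c * x) (c * y) \<le> cmod c * F x y" for c x y
  proof (rule LIMSEQ_le[OF W_lim tendsto_mult_left[OF W_lim]])
    have "W n (c * x) (c * y) \<le> cmod c * W n x y" for n
      by (rule W_leI) (simp add: f_hom W_ge mult_left_mono)
    then show "\<exists>N. \<forall>n\<ge>N. W n (c * x) (c * y) \<le> cmod c * W n x y" by blast
  qed
  have F_hom: "F (c * x) (c * y) = cmod c * F x y" for c x y
  proof (cases "c = 0")
    case True
    then show ?thesis using F_hom_le[of 0 x y] F_nonneg[of 0 0] by simp
  next
    case False
    then have "1 / c * (c * z) = z" for z by simp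
    then have "F x y \<le> F (c * x) (c * y) / cmod c"
      using F_hom_le[of "1 / c" "c * x" "c * y"] by (simp only: norm_divide norm_one) simp
    then have "cmod c * F x y \<le> F (c * x) (c * y)"
      using False by (simp add: pos_le_divide_eq mult.commute)
    then show ?thesis using F_hom_le[of c x y] by simp
  qed
  have F_tri: "F (x + x') (y + y') \<le> F x y + F x' y'" for x x' y y'
  proof (rule LIMSEQ_le[OF W_lim tendsto_add[OF W_lim W_lim]])
    have "W n (x + x') (y + y') \<le> W n x y + W n x' y'" for n
      by (rule W_leI, rule order_trans[OF f_tri]) (intro add_mono W_ge)
    then show "\<exists>N. \<forall>n\<ge>N. W n (x + x') (y + y') \<le> W n x y + W n x' y'" by blast
  qed
  have F_step: "r * F x y = max (F (x + y) y) (\<alpha> * F x (x + y))" for x y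
  proof (rule LIMSEQ_unique)
    show "(\<lambda>n. r * W (Suc n) x y) \<longlonglongrightarrow> r * F x y"
      by (intro tendsto_mult_left LIMSEQ_Suc W_lim)
    show "(\<lambda>n. r * W (Suc n) x y) \<longlonglongrightarrow> max (F (x + y) y) (\<alpha> * F x (x + y))"
      unfolding W_step by (intro tendsto_max tendsto_mult_left W_lim)
  qed
  have F_one: "1 \<le> F 1 1"
    using LIMSEQ_le_const[OF W_lim, of 1 1 1] W_ge[of _ 0 1 1] f_one by (metis order_trans)
  text \<open>The null space of \<open>F\<close> is invariant under both matrices, which have no common eigenvector.\<close>
  have null: "x = 0 \<and> y = 0" if "F x y = 0" for x y
  proof -
    have inv: "F (x + y) y = 0 \<and> F x (x + y) = 0" if "F x y = 0" for x y
      using F_step[of x y] F_nonneg[of "x + y" y] F_nonneg[of x "x + y"] that \<alpha>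
      by (auto simp: max_def mult_le_0_iff split: if_splits)
    have diff: "F (x - x') (y - y') = 0" if "F x y = 0" "F x' y' = 0" for x x' y y'
      using F_tri[of x "-x'" y "-y'"] F_hom[of "-1" x' y'] F_nonneg[of "x - x'" "y - y'"] that by simp
    \<comment> \<open>Subtracting \<open>(x, y)\<close> from its two images leaves
      \<open>(y, 0)\<close> and \<open>(0, x)\<close>. One further letter produces multiples of
      \<open>(1, 1)\<close>, where \<open>F\<close> is positive.\<close>
    have "F y 0 = 0" "F 0 x = 0" using diff[of "x + y" y x y] diff[of x "x + y" x y] inv[OF that] that by simp_all
    then have "cmod y * F 1 1 = 0" "cmod x * F 1 1 = 0"
      using inv[of y 0] inv[of 0 x] F_hom[of y 1 1] F_hom[of x 1 1] by simp_all
    then show ?thesis using F_one by auto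
  qed
  have "barabanov_pair \<alpha> r F"
    by unfold_locales (use \<alpha> F_nonneg null F_hom F_tri F_step in auto)
  then show ?thesis by blast
qed

end

section \<open>Passage between matrices and coordinates\<close>

lemma matrix_actions:
  "A1 *v v = vector [v $ 1 + v $ 2, v $ 2]"
  "(\<alpha> *\<^sub>R A2) *v v = of_real \<alpha> *s vector [v $ 1, v $ 1 + v $ 2]"
  by (simp_all add: vec_eq_iff forall_2 matrix_vector_mult_def sum_2 A1_def A2_def
      vector_2 scaleR_conv_of_real[where 'a = complex] distrib_left)

lemma Max_A_pair: "Max {N (A *v v) | A. A \<in> A_pair \<alpha>} = max (N (A1 *v v)) (N ((\<alpha> *\<^sub>R A2) *v v))"
proof -
  have "{N (A *v v) | A. A \<in> A_pair \<alpha>} = {N (A1 *v v), N ((\<alpha> *\<^sub>R A2) *v v)}"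
    unfolding A_pair_def by blast
  then show ?thesis by simp
qed

lemma vector_2_ops:
  fixes x y x' y' c :: complex
  shows "vector [c * x, c * y] = c *s (vector [x, y] :: complex ^ 2)"
    and "vector [x + x', y + y'] = (vector [x, y] + vector [x', y'] :: complex ^ 2)"
    and "(vector [x, y] :: complex ^ 2) = 0 \<longleftrightarrow> x = 0 \<and> y = 0"
  by (simp_all add: vec_eq_iff forall_2 vector_2)

lemma barabanov_pairI:
  assumes \<alpha>: "0 < \<alpha>" "\<alpha> \<le> 1" and N: "barabanov_norm (A_pair \<alpha>) N"
  shows "barabanov_pair \<alpha> (joint_spectral_radius (A_pair \<alpha>)) (\<lambda>x y. N (vector [x, y]))"
proof -
  have norm: "0 \<le> N v" "N v = 0 \<longleftrightarrow> v = 0" "N (c *s v) = cmod c * N v" "N (v + w) \<le> N v + N w" for v w c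
    using N unfolding barabanov_norm_def is_norm_def by blast+
  have "joint_spectral_radius (A_pair \<alpha>) * N v = max (N (A1 *v v)) (N ((\<alpha> *\<^sub>R A2) *v v))" for v
    using N unfolding barabanov_norm_def Max_A_pair by blast
  then show ?thesis
    using \<alpha> norm by unfold_locales (simp_all add: vector_2_ops matrix_actions vector_2)
qed

lemma barabanov_normI:
  assumes "barabanov_pair \<alpha> r F"
  shows "barabanov_norm (A_pair \<alpha>) (\<lambda>v. F (v $ 1) (v $ 2))"
proof -
  interpret barabanov_pair \<alpha> r F by fact
  let ?N = "\<lambda>v :: complex ^ 2. F (v $ 1) (v $ 2)"
  have "F 0 0 = 0" using hom[of 0 0 0] by simp
  then have zero: "F x y = 0 \<longleftrightarrow> x = 0 \<and> y = 0" for x y using definite[of x y] by auto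
  have norm: "is_norm ?N"
    unfolding is_norm_def by (simp add: nonneg zero hom triangle vec_eq_iff forall_2)
  have max: "r * ?N v = Max {?N (A *v v) | A. A \<in> A_pair \<alpha>}" for v
    unfolding Max_A_pair[of ?N] matrix_actions
    using step[of "v $ 1" "v $ 2"] \<alpha>_pos by (simp add: vector_2 hom)
  have "joint_spectral_radius (A_pair \<alpha>) = r"
    by (rule joint_spectral_radius_eq[OF _ _ norm max]) (simp_all add: A_pair_def)
  then show ?thesis unfolding barabanov_norm_def using norm max by simp
qed

theorem theorem7p4:
  fixes \<alpha> :: real
  assumes "0 < \<alpha>" and "\<alpha> \<le> 1"
  shows "has_unique_barabanov_norm (A_pair \<alpha>)"
  unfolding has_unique_barabanov_norm_def
proof (intro conjI allI impI)
  show "\<exists>N. barabanov_norm (A_pair \<alpha>) N"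
    using barabanov_pair_exists[OF assms] barabanov_normI by blast
next
  fix N N' assume "barabanov_norm (A_pair \<alpha>) N" "barabanov_norm (A_pair \<alpha>) N'"
  \<comment> \<open>Both norms satisfy the equation with the same constant, the joint spectral
    radius, as the comparison requires.\<close>
  then obtain k where k: "0 < k" "\<And>x y. N' (vector [x, y]) = k * N (vector [x, y])"
    using barabanov_pair_unique[OF barabanov_pairI barabanov_pairI, OF assms _ assms] by metis
  have "vector [v $ 1, v $ 2] = v" for v :: "complex ^ 2"
    by (simp add: vec_eq_iff forall_2 vector_2)
  then have "N' v = k * N v" for v using k(2)[of "v $ 1" "v $ 2"] by simp
  then show "\<exists>c>0. \<forall>v. N' v = c * N v" using k(1) by blast
qed

end
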